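(* Every left Rees category is isomorphic to a Zappa-Szép product $\mathcal{G}^{*}\bowtie G$ of a free category $\mathcal{G}^{*}$ (on a directed graph $\mathcal{G}$) by a groupoid $G$.
   Context: All categories are small and treated as sets of arrows with partial multiplication, objects being identified with identity arrows; each arrow $x$ has a domain $\mathbf{d}(x)$ and codomain $\mathbf{r}(x)$ with $x=x\mathbf{d}(x)=\mathbf{r}(x)x$, and $xy$ is defined iff $\mathbf{d}(x)=\mathbf{r}(y)$. $C_0$ is the set of identities of $C$. A principal right ideal of $C$ is a set $xC$, $x\in C$. $C$ is right rigid if $xC\cap yC\neq\emptyset$ implies $xC\subseteq yC$ or $yC\subseteq xC$. A left Rees category is a small category which is left cancellative, right rigid, and in which each principal right ideal is properly contained in only finitely many distinct principal right ideals. The free category $\mathcal{G}^*$ on a directed graph $\mathcal{G}$ has as identities the vertices and as non-identity arrows the non-empty sequences $x_1\cdots x_n$ of edges with $\mathbf{d}(x_i)=\mathbf{r}(x_{i+1})$, under concatenation. A self-similar action of a groupoid $G$ on a category $C$, where $G_0$ and $C_0$ are identified, consists of functions $(g,x)\mapsto g\cdot x\in C$ and $(g,x)\mapsto g|_x\in G$ defined on pairs with $g^{-1}g=\mathbf{r}(x)$ such that: (C1) $\mathbf{r}(g\cdot x)=gg^{-1}$; (C2) $\mathbf{d}(g\cdot x)=g|_x(g|_x)^{-1}$; (C3) $\mathbf{d}(x)=(g|_x)^{-1}g|_x$; (SS1) $\mathbf{r}(x)\cdot x=x$; (SS2) if $gh$ is defined and $h^{-1}h=\mathbf{r}(x)$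 then $(gh)\cdot x=g\cdot(h\cdot x)$; (SS3) $gg^{-1}=g\cdot g^{-1}g$; (SS4) $\mathbf{r}(x)|_x=\mathbf{d}(x)$; (SS5) $g|_{g^{-1}g}=g$; (SS6) if $xy$ is defined and $g^{-1}g=\mathbf{r}(x)$ then $g|_{xy}=(g|_x)|_y$; (SS7) if $gh$ is defined and $h^{-1}h=\mathbf{r}(x)$ then $(gh)|_x=g|_{h\cdot x}h|_x$; (SS8) if $xy$ is defined and $g^{-1}g=\mathbf{r}(x)$ then $g\cdot(xy)=(g\cdot x)(g|_x\cdot y)$. The Zappa-Szép product $C\bowtie G$ is the category with arrows $\{(x,g)\in C\times G:\mathbf{d}(x)=gg^{-1}\}$, with $\mathbf{d}(x,g)=(g^{-1}g,g^{-1}g)$, $\mathbf{r}(x,g)=(\mathbf{r}(x),\mathbf{r}(x))$ and product $(x,g)(y,h)=(x(g\cdot y),g|_yh)$, defined when $g^{-1}g=\mathbf{r}(y)$. Two categories are isomorphic if there is a functor between them that is bijective on identities and on non-identity arrows. *)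

theory Defs
  imports "Graph_Theory.Digraph"
begin

text \<open>
  Small categories are sets of arrows with a partial multiplication; objects are the identity
  arrows. The product \<open>x \<cdot>\<^bsub>C\<^esub> y\<close> is meaningful only if \<open>cdom C x = ccod C y\<close>
  (composition from right to left); the values of the three operations elsewhere are irrelevant.
\<close>

record 'a category =
  arrs :: "'a set"
  cdom :: "'a \<Rightarrow> 'a"
  ccod :: "'a \<Rightarrow> 'a"
  cmul :: "'a \<Rightarrow> 'a \<Rightarrow> 'a" (infixl \<open>\<cdot>\<index>\<close> 70)

definition idents :: "'a category \<Rightarrow> 'a set" where
  "idents C = {e \<in> arrs C. cdom C e = e}"

locale small_category =
  fixes C :: "'a category" (structure)
  assumes cdom_closed: "x \<in> arrs C \<Longrightarrow> cdom C x \<in> arrs C"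
    and ccod_closed: "x \<in> arrs C \<Longrightarrow> ccod C x \<in> arrs C"
    and cdom_cdom: "x \<in> arrs C \<Longrightarrow> cdom C (cdom C x) = cdom C x"
    and ccod_cdom: "x \<in> arrs C \<Longrightarrow> ccod C (cdom C x) = cdom C x"
    and cdom_ccod: "x \<in> arrs C \<Longrightarrow> cdom C (ccod C x) = ccod C x"
    and ccod_ccod: "x \<in> arrs C \<Longrightarrow> ccod C (ccod C x) = ccod C x"
    and mul_closed: "\<lbrakk>x \<in> arrs C; y \<in> arrs C; cdom C x = ccod C y\<rbrakk> \<Longrightarrow> x \<cdot> y \<in> arrs C"
    and cdom_mul: "\<lbrakk>x \<in> arrs C; y \<in> arrs C; cdom C x = ccod C y\<rbrakk> \<Longrightarrow> cdom C (x \<cdot> y) = cdom C y"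
    and ccod_mul: "\<lbrakk>x \<in> arrs C; y \<in> arrs C; cdom C x = ccod C y\<rbrakk> \<Longrightarrow> ccod C (x \<cdot> y) = ccod C x"
    and mul_cdom: "x \<in> arrs C \<Longrightarrow> x \<cdot> cdom C x = x"
    and ccod_mul_self: "x \<in> arrs C \<Longrightarrow> ccod C x \<cdot> x = x"
    and mul_assoc: "\<lbrakk>x \<in> arrs C; y \<in> arrs C; z \<in> arrs C; cdom C x = ccod C y; cdom C y = ccod C z\<rbrakk>
      \<Longrightarrow> (x \<cdot> y) \<cdot> z = x \<cdot> (y \<cdot> z)"

locale groupoid = small_category G for G :: "'g category" (structure) +
  assumes has_inverse: "g \<in> arrs G \<Longrightarrow>
    \<exists>h\<in>arrs G. cdom G h = ccod G g \<and> ccod G h = cdom G g \<and> h \<cdot> g = cdom G g \<and> g \<cdot> h = ccod G g"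

definition principal_right_ideal :: "'a category \<Rightarrow> 'a \<Rightarrow> 'a set" where
  "principal_right_ideal C x = {x \<cdot>\<^bsub>C\<^esub> y | y. y \<in> arrs C \<and> cdom C x = ccod C y}"

locale left_rees_category = small_category C for C :: "'a category" (structure) +
  assumes left_cancellative: "\<lbrakk>x \<in> arrs C; y \<in> arrs C; z \<in> arrs C;
      cdom C x = ccod C y; cdom C x = ccod C z; x \<cdot> y = x \<cdot> z\<rbrakk> \<Longrightarrow> y = z"
    and right_rigid: "\<lbrakk>x \<in> arrs C; y \<in> arrs C;
      principal_right_ideal C x \<inter> principal_right_ideal C y \<noteq> {}\<rbrakk> \<Longrightarrow>
      principal_right_ideal C x \<subseteq> principal_right_ideal C y \<or>
      principal_right_ideal C y \<subseteq> principal_right_ideal C x"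
    and finite_above: "x \<in> arrs C \<Longrightarrow>
      finite {I \<in> principal_right_ideal C ` arrs C. principal_right_ideal C x \<subset> I}"

text \<open>
  The free category on a directed graph. Since \<open>x\<^sub>1 \<dots> x\<^sub>n\<close> composes from right to left, the
  domain of an edge is its tail, its codomain is its head, and \<open>x\<^sub>1 \<dots> x\<^sub>n\<close> is a walk listed
  in reverse.
\<close>

datatype ('v, 'e) free_arrow = Vertex 'v | Word "'e list"

fun free_dom :: "('v, 'e) pre_digraph \<Rightarrow> ('v, 'e) free_arrow \<Rightarrow> ('v, 'e) free_arrow" where
  "free_dom \<G> (Vertex v) = Vertex v"
| "free_dom \<G> (Word xs) = Vertex (tail \<G> (last xs))"

fun free_cod :: "('v, 'e) pre_digraph \<Rightarrow> ('v, 'e) free_arrow \<Rightarrow> ('v, 'e) free_arrow" where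
  "free_cod \<G> (Vertex v) = Vertex v"
| "free_cod \<G> (Word xs) = Vertex (head \<G> (hd xs))"

fun free_mul :: "('v, 'e) free_arrow \<Rightarrow> ('v, 'e) free_arrow \<Rightarrow> ('v, 'e) free_arrow" where
  "free_mul (Vertex v) p = p"
| "free_mul (Word xs) (Vertex v) = Word xs"
| "free_mul (Word xs) (Word ys) = Word (xs @ ys)"

definition free_category :: "('v, 'e) pre_digraph \<Rightarrow> ('v, 'e) free_arrow category" where
  "free_category \<G> = \<lparr>
     arrs = Vertex ` verts \<G> \<union>
       {Word xs | xs. xs \<noteq> [] \<and> set xs \<subseteq> arcs \<G> \<and> successively (\<lambda>x y. tail \<G> x = head \<G> y) xs},
     cdom = free_dom \<G>,
     ccod = free_cod \<G>,
     cmul = free_mul\<rparr>"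

text \<open>
  Self-similar actions. The identification of \<open>G\<^sub>0\<close> with \<open>C\<^sub>0\<close> is an explicit bijection
  \<open>\<iota>\<close>, with inverse \<open>obj_inv G \<iota>\<close>. In a groupoid \<open>g\<inverse>g\<close> is \<open>cdom G g\<close> and
  \<open>gg\<inverse>\<close> is \<open>ccod G g\<close>.
\<close>

definition obj_inv :: "'g category \<Rightarrow> ('g \<Rightarrow> 'a) \<Rightarrow> 'a \<Rightarrow> 'g" where
  "obj_inv G \<iota> = the_inv_into (idents G) \<iota>"

locale self_similar_action = G: groupoid G + C: small_category C
  for G :: "'g category" and C :: "'a category" +
  fixes \<iota> :: "'g \<Rightarrow> 'a"
    and act :: "'g \<Rightarrow> 'a \<Rightarrow> 'a"
    and res :: "'g \<Rightarrow> 'a \<Rightarrow> 'g"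
  assumes identification: "bij_betw \<iota> (idents G) (idents C)"
    and act_closed: "\<lbrakk>g \<in> arrs G; x \<in> arrs C; \<iota> (cdom G g) = ccod C x\<rbrakk> \<Longrightarrow> act g x \<in> arrs C"
    and res_closed: "\<lbrakk>g \<in> arrs G; x \<in> arrs C; \<iota> (cdom G g) = ccod C x\<rbrakk> \<Longrightarrow> res g x \<in> arrs G"
    and C1: "\<lbrakk>g \<in> arrs G; x \<in> arrs C; \<iota> (cdom G g) = ccod C x\<rbrakk>
      \<Longrightarrow> ccod C (act g x) = \<iota> (ccod G g)"
    and C2: "\<lbrakk>g \<in> arrs G; x \<in> arrs C; \<iota> (cdom G g) = ccod C x\<rbrakk>
      \<Longrightarrow> cdom C (act g x) = \<iota> (ccod G (res g x))"
    and C3: "\<lbrakk>g \<in> arrs G; x \<in> arrs C; \<iota> (cdom G g) = ccod C x\<rbrakk>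
      \<Longrightarrow> cdom C x = \<iota> (cdom G (res g x))"
    and SS1: "x \<in> arrs C \<Longrightarrow> act (obj_inv G \<iota> (ccod C x)) x = x"
    and SS2: "\<lbrakk>g \<in> arrs G; h \<in> arrs G; cdom G g = ccod G h; x \<in> arrs C; \<iota> (cdom G h) = ccod C x\<rbrakk>
      \<Longrightarrow> act (g \<cdot>\<^bsub>G\<^esub> h) x = act g (act h x)"
    and SS3: "g \<in> arrs G \<Longrightarrow> \<iota> (ccod G g) = act g (\<iota> (cdom G g))"
    and SS4: "x \<in> arrs C \<Longrightarrow> res (obj_inv G \<iota> (ccod C x)) x = obj_inv G \<iota> (cdom C x)"
    and SS5: "g \<in> arrs G \<Longrightarrow> res g (\<iota> (cdom G g)) = g"
    and SS6: "\<lbrakk>x \<in> arrs C; y \<in> arrs C; cdom C x = ccod C y; g \<in> arrs G; \<iota> (cdom G g) = ccod C x\<rbrakk>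
      \<Longrightarrow> res g (x \<cdot>\<^bsub>C\<^esub> y) = res (res g x) y"
    and SS7: "\<lbrakk>g \<in> arrs G; h \<in> arrs G; cdom G g = ccod G h; x \<in> arrs C; \<iota> (cdom G h) = ccod C x\<rbrakk>
      \<Longrightarrow> res (g \<cdot>\<^bsub>G\<^esub> h) x = res g (act h x) \<cdot>\<^bsub>G\<^esub> res h x"
    and SS8: "\<lbrakk>x \<in> arrs C; y \<in> arrs C; cdom C x = ccod C y; g \<in> arrs G; \<iota> (cdom G g) = ccod C x\<rbrakk>
      \<Longrightarrow> act g (x \<cdot>\<^bsub>C\<^esub> y) = act g x \<cdot>\<^bsub>C\<^esub> act (res g x) y"

definition zappa_szep ::
  "'a category \<Rightarrow> 'g category \<Rightarrow> ('g \<Rightarrow> 'a) \<Rightarrow> ('g \<Rightarrow> 'a \<Rightarrow> 'a) \<Rightarrow> ('g \<Rightarrow> 'a \<Rightarrow> 'g) \<Rightarrow> ('a \<times> 'g) category"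
where
  "zappa_szep C G \<iota> act res = \<lparr>
     arrs = {(x, g). x \<in> arrs C \<and> g \<in> arrs G \<and> cdom C x = \<iota> (ccod G g)},
     cdom = (\<lambda>(x, g). (\<iota> (cdom G g), cdom G g)),
     ccod = (\<lambda>(x, g). (ccod C x, obj_inv G \<iota> (ccod C x))),
     cmul = (\<lambda>(x, g) (y, h). (x \<cdot>\<^bsub>C\<^esub> act g y, res g y \<cdot>\<^bsub>G\<^esub> h))\<rparr>"

definition is_functor :: "('a \<Rightarrow> 'b) \<Rightarrow> 'a category \<Rightarrow> 'b category \<Rightarrow> bool" where
  "is_functor F C D \<longleftrightarrow>
     (\<forall>x\<in>arrs C. F x \<in> arrs D \<and> F (cdom C x) = cdom D (F x) \<and> F (ccod C x) = ccod D (F x)) \<and>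
     (\<forall>x\<in>arrs C. \<forall>y\<in>arrs C. cdom C x = ccod C y \<longrightarrow> F (x \<cdot>\<^bsub>C\<^esub> y) = F x \<cdot>\<^bsub>D\<^esub> F y)"

definition category_isomorphic :: "'a category \<Rightarrow> 'b category \<Rightarrow> bool" where
  "category_isomorphic C D \<longleftrightarrow>
     (\<exists>F. is_functor F C D \<and> bij_betw F (idents C) (idents D) \<and>
       bij_betw F (arrs C - idents C) (arrs D - idents D))"

end

theory Submission
  imports Defs
begin

text \<open>
  The groupoid is the groupoid of units (invertible arrows) of the left Rees category \<open>C\<close>, and
  the edges of the graph are atoms: non-units all of whose two-term factorizations contain a
  unit. More precisely, the edges form a transversal that picks one generator from each
  principal right ideal generated by an atom; an edge \<open>x\<close> runs from the identity \<open>cdom C x\<close> to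
  the identity \<open>ccod C x\<close>. The theorem amounts to the claim that every arrow of \<open>C\<close> is, in a
  unique way, a product of a path of edges followed by a unit.

  Existence (\<open>ex_factorization\<close>). An ideal properly above \<open>cC\<close> that is minimal with this
  property is of the form \<open>bC\<close>; then \<open>c = ba\<close>, and by minimality and left cancellation \<open>a\<close> is an
  atom. Fewer ideals lie above \<open>bC\<close> than above \<open>cC\<close>, so by induction \<open>b\<close> is a path \<open>p\<close> times a unit
  \<open>g\<close>. Now \<open>ga\<close> is again an atom, so it is an edge \<open>x\<close> times a unit, and \<open>px\<close> is the path for \<open>c\<close>.

  Uniqueness (\<open>word_product_cancel\<close>). If two products of edges and a unit are equal, the
  ideals of the two leading edges meet, so right rigidity makes them comparable.
  Comparable ideals of atoms are equal, hence the two edges are the same and can be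
  cancelled. A product that starts with an edge is never a unit, because right invertible
  arrows are units in a left cancellative category.

  Unique factorization \<open>c = pg\<close> alone yields the Zappa-Szep decomposition
  (locale \<open>internal_zappa_szep\<close>): factorizing \<open>gp\<close> as \<open>(g \<cdot> p) g|\<^sub>p\<close> defines the two actions, each
  of the axioms SS1 to SS8 compares two factorizations of one arrow, and
  factorizing is the required isomorphism.
\<close>

section \<open>Isomorphisms and free categories\<close>

text \<open>
  A functor preserves identities, and an injective one also reflects them: if \<open>F x\<close> is an
  identity, then \<open>F x = F (cdom C x)\<close>. So bijectivity on all arrows already splits into the two
  bijections that an isomorphism requires.
\<close>

lemma category_isomorphicI:
  assumes "small_category C" and F: "is_functor F C D" and bij: "bij_betw F (arrs C) (arrs D)"
  shows "category_isomorphic C D"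
proof -
  interpret small_category C by fact
  have reflect: "x \<in> idents C" if "x \<in> arrs C" "F x \<in> idents D" for x
  proof -
    have "F (cdom C x) = F x"
      using F that by (auto simp: is_functor_def idents_def)
    then show ?thesis
      using bij that cdom_closed by (auto simp: bij_betw_def inj_on_def idents_def)
  qed
  have preserve: "F x \<in> idents D" if "x \<in> idents C" for x
    using F that unfolding is_functor_def idents_def by (metis (mono_tags, lifting) mem_Collect_eq)
  have im: "F ` arrs C = arrs D" and inj: "inj_on F (arrs C)"
    using bij by (auto simp: bij_betw_def)
  have sub: "idents C \<subseteq> arrs C" "idents D \<subseteq> arrs D" by (auto simp: idents_def)
  have "F ` idents C = idents D"
  proof
    show "F ` idents C \<subseteq> idents D" using preserve by auto
    show "idents D \<subseteq> F ` idents C"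
    proof
      fix y assume "y \<in> idents D"
      moreover from this obtain x where "x \<in> arrs C" "y = F x" using im sub by blast
      ultimately show "y \<in> F ` idents C" using reflect by auto
    qed
  qed
  moreover have "F ` (arrs C - idents C) = F ` arrs C - F ` idents C"
    using inj sub by (intro inj_on_image_set_diff) auto
  ultimately have "bij_betw F (idents C) (idents D)"
    "bij_betw F (arrs C - idents C) (arrs D - idents D)"
    using im inj sub by (auto simp: bij_betw_def intro: inj_on_subset)
  with F show ?thesis unfolding category_isomorphic_def by blast
qed

definition walk :: "'a category \<Rightarrow> 'a list \<Rightarrow> bool" where
  "walk C xs \<longleftrightarrow> xs \<noteq> [] \<and> set xs \<subseteq> arrs C \<and> successively (\<lambda>x y. cdom C x = ccod C y) xs"

text \<open>
  The letters are arbitrary arrows and not only edges of a graph: a path \<open>xs\<close> followed by a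
  unit \<open>g\<close> can then be treated as the single word \<open>xs @ [g]\<close>.
\<close>

fun word_product :: "'a category \<Rightarrow> 'a list \<Rightarrow> 'a" where
  "word_product C [] = undefined"
| "word_product C [x] = x"
| "word_product C (x # y # ys) = x \<cdot>\<^bsub>C\<^esub> word_product C (y # ys)"

text \<open>
  The functor that extends an inclusion of edges into \<open>C\<close> to the free category.
\<close>

fun free_eval :: "'a category \<Rightarrow> ('a, 'a) free_arrow \<Rightarrow> 'a" where
  "free_eval C (Vertex v) = v"
| "free_eval C (Word xs) = word_product C xs"

definition subgraph_on :: "'a category \<Rightarrow> 'a set \<Rightarrow> ('a, 'a) pre_digraph" where
  "subgraph_on C X = \<lparr>verts = idents C, arcs = X, tail = cdom C, head = ccod C\<rparr>"

lemma successively_append_nonempty: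
  assumes "xs \<noteq> []" "ys \<noteq> []"
  shows "successively P (xs @ ys) \<longleftrightarrow> successively P xs \<and> successively P ys \<and> P (last xs) (hd ys)"
  using assms by (auto simp: successively_append_iff)

lemma arrs_free_category_cases:
  assumes "p \<in> arrs (free_category \<G>)"
  obtains (Vertex) v where "p = Vertex v" "v \<in> verts \<G>"
  | (Word) xs where "p = Word xs" "xs \<noteq> []" "set xs \<subseteq> arcs \<G>"
      "successively (\<lambda>x y. tail \<G> x = head \<G> y) xs"
  using assms by (auto simp: free_category_def)

lemma small_category_free_category:
  assumes "wf_digraph \<G>"
  shows "small_category (free_category \<G>)"
proof -
  interpret wf_digraph \<G> by fact
  have tail: "tail \<G> (last xs) \<in> verts \<G>" and head: "head \<G> (hd xs) \<in> verts \<G>"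
    if "xs \<noteq> []" "set xs \<subseteq> arcs \<G>" for xs
    using that last_in_set[of xs] hd_in_set[of xs] tail_in_verts head_in_verts by blast+
  show ?thesis
  proof
    fix x y z
    assume x: "x \<in> arrs (free_category \<G>)"
    show "cdom (free_category \<G>) x \<in> arrs (free_category \<G>)"
      "ccod (free_category \<G>) x \<in> arrs (free_category \<G>)"
      using x tail head by (auto simp: free_category_def)
    show "cdom (free_category \<G>) (cdom (free_category \<G>) x) = cdom (free_category \<G>) x"
      "ccod (free_category \<G>) (cdom (free_category \<G>) x) = cdom (free_category \<G>) x"
      "cdom (free_category \<G>) (ccod (free_category \<G>) x) = ccod (free_category \<G>) x"
      "ccod (free_category \<G>) (ccod (free_category \<G>) x) = ccod (free_category \<G>) x"
      "x \<cdot>\<^bsub>free_category \<G>\<^esub> cdom (free_category \<G>) x = x"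
      "ccod (free_category \<G>) x \<cdot>\<^bsub>free_category \<G>\<^esub> x = x"
      by (cases x; simp add: free_category_def)+
    assume y: "y \<in> arrs (free_category \<G>)"
      and xy: "cdom (free_category \<G>) x = ccod (free_category \<G>) y"
    show "x \<cdot>\<^bsub>free_category \<G>\<^esub> y \<in> arrs (free_category \<G>)"
      "cdom (free_category \<G>) (x \<cdot>\<^bsub>free_category \<G>\<^esub> y) = cdom (free_category \<G>) y"
      "ccod (free_category \<G>) (x \<cdot>\<^bsub>free_category \<G>\<^esub> y) = ccod (free_category \<G>) x"
      using x y xy by (auto simp: free_category_def successively_append_nonempty)
    assume "z \<in> arrs (free_category \<G>)" "cdom (free_category \<G>) y = ccod (free_category \<G>) z"
    then show "x \<cdot>\<^bsub>free_category \<G>\<^esub> y \<cdot>\<^bsub>free_category \<G>\<^esub> z =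
        x \<cdot>\<^bsub>free_category \<G>\<^esub> (y \<cdot>\<^bsub>free_category \<G>\<^esub> z)"
      using x y xy by (auto simp: free_category_def)
  qed
qed

lemma idents_free_category: "idents (free_category \<G>) = Vertex ` verts \<G>"
  by (auto simp: idents_def free_category_def)

context small_category
begin

lemma walk_Cons_Cons: "walk C (x # y # ys) \<longleftrightarrow> x \<in> arrs C \<and> cdom C x = ccod C y \<and> walk C (y # ys)"
  by (auto simp: walk_def)

lemma word_product_Cons: "ys \<noteq> [] \<Longrightarrow> word_product C (x # ys) = x \<cdot> word_product C ys"
  by (cases ys) auto

lemma word_product_walk:
  assumes "walk C xs"
  shows "word_product C xs \<in> arrs C \<and> cdom C (word_product C xs) = cdom C (last xs) \<and>
    ccod C (word_product C xs) = ccod C (hd xs)"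
  using assms
proof (induction xs rule: induct_list012)
  case (3 x y ys)
  then show ?case
    by (auto simp: walk_Cons_Cons mul_closed cdom_mul ccod_mul)
qed (auto simp: walk_def)

lemma walk_append:
  assumes "xs \<noteq> []" "ys \<noteq> []"
  shows "walk C (xs @ ys) \<longleftrightarrow> walk C xs \<and> walk C ys \<and> cdom C (last xs) = ccod C (hd ys)"
  using assms by (auto simp: walk_def successively_append_nonempty)

lemma word_product_append:
  assumes "walk C xs" "walk C ys" "cdom C (last xs) = ccod C (hd ys)"
  shows "word_product C (xs @ ys) = word_product C xs \<cdot> word_product C ys"
  using assms
proof (induction xs rule: induct_list012)
  case (2 x)
  then show ?case by (simp add: word_product_Cons walk_def)
next
  case (3 x y zs)
  have "word_product C ((x # y # zs) @ ys) = x \<cdot> (word_product C (y # zs) \<cdot> word_product C ys)"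
    using 3 by (simp add: walk_Cons_Cons)
  also have "\<dots> = (x \<cdot> word_product C (y # zs)) \<cdot> word_product C ys"
    using 3 word_product_walk[of "y # zs"] word_product_walk[of ys]
    by (intro mul_assoc[symmetric]) (auto simp: walk_Cons_Cons)
  finally show ?case by simp
qed (auto simp: walk_def)

lemma cdom_ident: "x \<in> arrs C \<Longrightarrow> cdom C x \<in> idents C"
  by (simp add: idents_def cdom_closed cdom_cdom)

lemma ccod_ident: "x \<in> arrs C \<Longrightarrow> ccod C x \<in> idents C"
  by (simp add: idents_def ccod_closed cdom_ccod)

lemma ident_simps: "e \<in> idents C \<Longrightarrow> e \<in> arrs C \<and> cdom C e = e \<and> ccod C e = e"
  unfolding idents_def using ccod_cdom by fastforce

lemma wf_digraph_subgraph_on: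
  assumes "X \<subseteq> arrs C"
  shows "wf_digraph (subgraph_on C X)"
  using assms by unfold_locales (auto simp: subgraph_on_def cdom_ident ccod_ident)

lemma is_functor_free_eval:
  assumes X: "X \<subseteq> arrs C"
  shows "is_functor (free_eval C) (free_category (subgraph_on C X)) C"
proof -
  let ?D = "free_category (subgraph_on C X)"
  note [simp] = free_category_def subgraph_on_def
  have walkI: "walk C xs" if "Word xs \<in> arrs ?D" for xs
    using that X by (auto simp: walk_def)
  have "free_eval C p \<in> arrs C \<and> free_eval C (cdom ?D p) = cdom C (free_eval C p) \<and>
      free_eval C (ccod ?D p) = ccod C (free_eval C p)" if "p \<in> arrs ?D" for p
  proof (cases p)
    case (Vertex v)
    then show ?thesis using that ident_simps by auto
  next
    case (Word xs)
    then show ?thesis using that walkI word_product_walk by auto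
  qed
  moreover have "free_eval C (p \<cdot>\<^bsub>?D\<^esub> q) = free_eval C p \<cdot> free_eval C q"
    if "p \<in> arrs ?D" "q \<in> arrs ?D" "cdom ?D p = ccod ?D q" for p q
  proof (cases p)
    case (Vertex v)
    then show ?thesis
      using that calculation[of q] ccod_mul_self[of "free_eval C q"] by auto
  next
    case p: (Word xs)
    show ?thesis
    proof (cases q)
      case (Vertex v)
      then show ?thesis
        using p that calculation[of p] mul_cdom[of "free_eval C p"] by auto
    next
      case (Word ys)
      then show ?thesis
        using p that walkI[of xs] walkI[of ys] word_product_append[of xs ys] by auto
    qed
  qed
  ultimately show ?thesis
    unfolding is_functor_def by blast
qed

end

section \<open>Internal Zappa-Szep products\<close>

text \<open>
  The situation of a category factorized by two wide subcategories, one of them a groupoid.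
  The groupoid is a subset \<open>U\<close> of \<open>C\<close>, while the other factor is only embedded by a functor \<open>ev\<close>,
  since it is going to be a category of formal paths; \<open>\<iota>\<close> inverts \<open>ev\<close> on identities.
\<close>

locale internal_zappa_szep = C: small_category C + D: small_category D
  for C :: "'a category" (structure) and D :: "'d category" +
  fixes U :: "'a set" and ev :: "'d \<Rightarrow> 'a" and \<iota> :: "'a \<Rightarrow> 'd"
  assumes subset: "U \<subseteq> arrs C" and idents_subset: "idents C \<subseteq> U"
    and groupoid: "groupoid (C\<lparr>arrs := U\<rparr>)"
    and ev_functor: "is_functor ev D C"
    and \<iota>_bij: "bij_betw \<iota> (idents C) (idents D)"
    and ev_\<iota>: "e \<in> idents C \<Longrightarrow> ev (\<iota> e) = e"
    and unique_factorization: "c \<in> arrs C \<Longrightarrow>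
      \<exists>!(p, g). p \<in> arrs D \<and> g \<in> U \<and> cdom C (ev p) = ccod C g \<and> ev p \<cdot> g = c"
begin

abbreviation G :: "'a category" where
  "G \<equiv> C\<lparr>arrs := U\<rparr>"

definition factors :: "'a \<Rightarrow> 'd \<times> 'a \<Rightarrow> bool" where
  "factors c = (\<lambda>(p, g). p \<in> arrs D \<and> g \<in> U \<and> cdom C (ev p) = ccod C g \<and> ev p \<cdot> g = c)"

definition factorize :: "'a \<Rightarrow> 'd \<times> 'a" where
  "factorize c = (THE pg. factors c pg)"

definition act :: "'a \<Rightarrow> 'd \<Rightarrow> 'd" where
  "act g p = fst (factorize (g \<cdot> ev p))"

definition res :: "'a \<Rightarrow> 'd \<Rightarrow> 'a" where
  "res g p = snd (factorize (g \<cdot> ev p))"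

lemma factors_ex1: "c \<in> arrs C \<Longrightarrow> \<exists>!pg. factors c pg"
  using unique_factorization unfolding factors_def by simp

lemma factorsI:
  "\<lbrakk>p \<in> arrs D; g \<in> U; cdom C (ev p) = ccod C g; ev p \<cdot> g = c\<rbrakk> \<Longrightarrow> factors c (p, g)"
  by (simp add: factors_def)

lemma ev_closed: "p \<in> arrs D \<Longrightarrow> ev p \<in> arrs C"
  and ev_cdom: "p \<in> arrs D \<Longrightarrow> ev (cdom D p) = cdom C (ev p)"
  and ev_ccod: "p \<in> arrs D \<Longrightarrow> ev (ccod D p) = ccod C (ev p)"
  and ev_mul: "\<lbrakk>p \<in> arrs D; q \<in> arrs D; cdom D p = ccod D q\<rbrakk> \<Longrightarrow> ev (p \<cdot>\<^bsub>D\<^esub> q) = ev p \<cdot> ev q"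
  using ev_functor by (auto simp: is_functor_def)

lemma U_closed: "g \<in> U \<Longrightarrow> g \<in> arrs C"
  using subset by auto

lemma U_mul: "\<lbrakk>g \<in> U; h \<in> U; cdom C g = ccod C h\<rbrakk> \<Longrightarrow> g \<cdot> h \<in> U"
proof -
  interpret G: groupoid G by (rule groupoid)
  show "\<lbrakk>g \<in> U; h \<in> U; cdom C g = ccod C h\<rbrakk> \<Longrightarrow> g \<cdot> h \<in> U"
    using G.mul_closed by simp
qed

lemma idents_G: "idents G = idents C"
  using subset idents_subset by (auto simp: idents_def)

lemma ident_D: "d \<in> idents D \<Longrightarrow> \<iota> (ev d) = d"
  using \<iota>_bij ev_\<iota> unfolding bij_betw_def by (metis imageE)

lemma cdom_D: "p \<in> arrs D \<Longrightarrow> cdom D p = \<iota> (cdom C (ev p))"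
  using ident_D[OF D.cdom_ident] ev_cdom by simp

lemma ccod_D: "p \<in> arrs D \<Longrightarrow> ccod D p = \<iota> (ccod C (ev p))"
  using ident_D[OF D.ccod_ident] ev_ccod by simp

lemma \<iota>_inject: "\<lbrakk>e \<in> idents C; f \<in> idents C\<rbrakk> \<Longrightarrow> \<iota> e = \<iota> f \<longleftrightarrow> e = f"
  by (metis ev_\<iota>)

lemma \<iota>_closed: "e \<in> idents C \<Longrightarrow> \<iota> e \<in> idents D"
  using \<iota>_bij by (auto simp: bij_betw_def)

lemma obj_inv_\<iota>: "e \<in> idents C \<Longrightarrow> obj_inv G \<iota> (\<iota> e) = e"
  using \<iota>_bij unfolding obj_inv_def idents_G by (simp add: the_inv_into_f_f bij_betw_def)

text \<open>
  This and the next lemma move the domain conditions of the action and of \<open>D\<close> into \<open>C\<close>, where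
  all computations with factorizations take place.
\<close>

lemma actable_iff:
  assumes "g \<in> U" "p \<in> arrs D"
  shows "\<iota> (cdom C g) = ccod D p \<longleftrightarrow> cdom C g = ccod C (ev p)"
  using assms ccod_D \<iota>_inject C.cdom_ident C.ccod_ident ev_closed U_closed by simp

lemma composable_iff:
  assumes "p \<in> arrs D" "q \<in> arrs D"
  shows "cdom D p = ccod D q \<longleftrightarrow> cdom C (ev p) = ccod C (ev q)"
  using assms cdom_D ccod_D \<iota>_inject C.cdom_ident C.ccod_ident ev_closed by simp

lemma factors_factorize: "c \<in> arrs C \<Longrightarrow> factors c (factorize c)"
  unfolding factorize_def by (rule theI') (rule factors_ex1)

lemma factors_arr: "factors c pg \<Longrightarrow> c \<in> arrs C"
  using C.mul_closed ev_closed U_closed by (auto simp: factors_def)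

lemma factorize_eq: "factors c pg \<Longrightarrow> factorize c = pg"
  using factors_ex1[OF factors_arr] factors_factorize[OF factors_arr] by blast

lemma factors_det: "\<lbrakk>factors c pg; factors d pg\<rbrakk> \<Longrightarrow> c = d"
  by (auto simp: factors_def)

lemma act_res:
  assumes "g \<in> U" "p \<in> arrs D" "cdom C g = ccod C (ev p)"
  shows "act g p \<in> arrs D" "res g p \<in> U" "cdom C (ev (act g p)) = ccod C (res g p)"
    "ev (act g p) \<cdot> res g p = g \<cdot> ev p"
  using factors_factorize[of "g \<cdot> ev p"] assms C.mul_closed U_closed ev_closed
  by (auto simp: act_def res_def factors_def split: prod.splits)

lemma act_res_ends:
  assumes "g \<in> U" "p \<in> arrs D" "cdom C g = ccod C (ev p)"
  shows "ccod C (ev (act g p)) = ccod C g" "cdom C (res g p) = cdom C (ev p)"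
  using act_res[OF assms] assms U_closed ev_closed
    C.ccod_mul[of "ev (act g p)" "res g p"] C.ccod_mul[of g "ev p"]
    C.cdom_mul[of "ev (act g p)" "res g p"] C.cdom_mul[of g "ev p"] by auto

text \<open>
  Uniqueness of factorization as a proof principle: the values of both actions are
  found by exhibiting any factorization of \<open>g \<cdot> ev p\<close>.
\<close>

lemma act_res_eqI:
  assumes "g \<in> U" "q \<in> arrs D" "h \<in> U" "cdom C (ev q) = ccod C h" "ev q \<cdot> h = g \<cdot> ev p"
  shows "act g p = q \<and> res g p = h"
  using factorize_eq[OF factorsI[of q h]] assms by (simp add: act_def res_def)

text \<open>
  Axioms SS2 and SS7: pushing first \<open>h\<close> and then \<open>g\<close> past \<open>p\<close> factorizes \<open>(gh)p = g(hp)\<close>.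
\<close>

lemma act_res_mul_left:
  assumes g: "g \<in> U" and h: "h \<in> U" and gh: "cdom C g = ccod C h"
    and p: "p \<in> arrs D" and hp: "cdom C h = ccod C (ev p)"
  shows "act (g \<cdot> h) p = act g (act h p) \<and> res (g \<cdot> h) p = res g (act h p) \<cdot> res h p"
proof (rule act_res_eqI)
  note H = act_res[OF h p hp] act_res_ends[OF h p hp]
  have ghp: "cdom C g = ccod C (ev (act h p))" using gh H by simp
  note GH = act_res[OF g H(1) ghp] act_res_ends[OF g H(1) ghp]
  note [simp] = ev_closed U_closed
  show "g \<cdot> h \<in> U" using g h gh by (rule U_mul)
  show "act g (act h p) \<in> arrs D" by (rule GH)
  show "res g (act h p) \<cdot> res h p \<in> U" using GH H by (intro U_mul) auto
  show "cdom C (ev (act g (act h p))) = ccod C (res g (act h p) \<cdot> res h p)"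
    using GH H by (simp add: C.ccod_mul)
  have "ev (act g (act h p)) \<cdot> (res g (act h p) \<cdot> res h p)
      = (ev (act g (act h p)) \<cdot> res g (act h p)) \<cdot> res h p"
    using GH H by (intro C.mul_assoc[symmetric]) auto
  also have "\<dots> = (g \<cdot> ev (act h p)) \<cdot> res h p" using GH by simp
  also have "\<dots> = g \<cdot> (ev (act h p) \<cdot> res h p)"
    using GH H g ghp by (intro C.mul_assoc) auto
  also have "\<dots> = g \<cdot> (h \<cdot> ev p)" using H by simp
  also have "\<dots> = (g \<cdot> h) \<cdot> ev p"
    using g h gh p hp by (intro C.mul_assoc[symmetric]) auto
  finally show "ev (act g (act h p)) \<cdot> (res g (act h p) \<cdot> res h p) = (g \<cdot> h) \<cdot> ev p" .
qed

text \<open>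
  Axioms SS6 and SS8: pushing \<open>g\<close> first past \<open>p\<close> and then past \<open>q\<close> factorizes \<open>g(pq) = (gp)q\<close>.
\<close>

lemma act_res_mul_right:
  assumes g: "g \<in> U" and p: "p \<in> arrs D" and q: "q \<in> arrs D"
    and gp: "cdom C g = ccod C (ev p)" and pq: "cdom D p = ccod D q"
  shows "act g (p \<cdot>\<^bsub>D\<^esub> q) = act g p \<cdot>\<^bsub>D\<^esub> act (res g p) q \<and> res g (p \<cdot>\<^bsub>D\<^esub> q) = res (res g p) q"
proof (rule act_res_eqI)
  note P = act_res[OF g p gp] act_res_ends[OF g p gp]
  have pq': "cdom C (ev p) = ccod C (ev q)" using composable_iff p q pq by simp
  then have rq: "cdom C (res g p) = ccod C (ev q)" using P by simp
  note Q = act_res[OF P(2) q rq] act_res_ends[OF P(2) q rq]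
  have comp: "cdom D (act g p) = ccod D (act (res g p) q)"
    using P Q by (simp add: composable_iff)
  note [simp] = ev_closed U_closed
  show "g \<in> U" by fact
  show "act g p \<cdot>\<^bsub>D\<^esub> act (res g p) q \<in> arrs D" using P Q comp by (intro D.mul_closed)
  show "res (res g p) q \<in> U" by (rule Q)
  show "cdom C (ev (act g p \<cdot>\<^bsub>D\<^esub> act (res g p) q)) = ccod C (res (res g p) q)"
    using P Q comp by (simp add: ev_mul C.cdom_mul)
  have "ev (act g p \<cdot>\<^bsub>D\<^esub> act (res g p) q) \<cdot> res (res g p) q
      = (ev (act g p) \<cdot> ev (act (res g p) q)) \<cdot> res (res g p) q"
    using P Q comp by (simp add: ev_mul)
  also have "\<dots> = ev (act g p) \<cdot> (ev (act (res g p) q) \<cdot> res (res g p) q)"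
    using P Q by (intro C.mul_assoc) auto
  also have "\<dots> = ev (act g p) \<cdot> (res g p \<cdot> ev q)" using Q by simp
  also have "\<dots> = (ev (act g p) \<cdot> res g p) \<cdot> ev q"
    using P q rq by (intro C.mul_assoc[symmetric]) auto
  also have "\<dots> = (g \<cdot> ev p) \<cdot> ev q" using P by simp
  also have "\<dots> = g \<cdot> (ev p \<cdot> ev q)"
    using g p q gp pq' by (intro C.mul_assoc) auto
  finally show "ev (act g p \<cdot>\<^bsub>D\<^esub> act (res g p) q) \<cdot> res (res g p) q = g \<cdot> ev (p \<cdot>\<^bsub>D\<^esub> q)"
    using p q pq by (simp add: ev_mul)
qed

lemma ident_U: "e \<in> idents C \<Longrightarrow> e \<in> U"
  using idents_subset by auto

text \<open>
  Axioms SS1 and SS4: for the identity \<open>e = ccod C (ev p)\<close>, the arrow \<open>ep = p\<close> has the factorization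
  \<open>p\<close> times an identity.
\<close>

lemma act_res_ident_left:
  assumes p: "p \<in> arrs D"
  shows "act (ccod C (ev p)) p = p \<and> res (ccod C (ev p)) p = cdom C (ev p)"
  using p ev_closed[OF p] C.cdom_ident C.ccod_ident
  by (intro act_res_eqI) (auto simp: ident_U C.ccod_cdom C.mul_cdom C.ccod_mul_self)

text \<open>
  Axioms SS3 and SS5: \<open>g\<close> times an identity is \<open>g\<close>, which factorizes as an identity times \<open>g\<close>.
\<close>

lemma act_res_ident_right:
  assumes g: "g \<in> U"
  shows "act g (\<iota> (cdom C g)) = \<iota> (ccod C g) \<and> res g (\<iota> (cdom C g)) = g"
  using g U_closed[OF g] C.cdom_ident C.ccod_ident \<iota>_closed D.ident_simps
  by (intro act_res_eqI) (auto simp: ev_\<iota> C.cdom_ccod C.mul_cdom C.ccod_mul_self)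

lemma self_similar_action: "self_similar_action G D \<iota> act res"
proof -
  interpret G: groupoid G by (rule groupoid)
  note [simp] = ev_closed U_closed ccod_D cdom_D actable_iff composable_iff
    C.cdom_ident C.ccod_ident obj_inv_\<iota> idents_G \<iota>_bij
  show ?thesis
  proof (intro_locales, unfold_locales)
    show "bij_betw \<iota> (idents G) (idents D)" by simp
    fix g h p q
    show "p \<in> arrs D \<Longrightarrow> act (obj_inv G \<iota> (ccod D p)) p = p"
      "p \<in> arrs D \<Longrightarrow> res (obj_inv G \<iota> (ccod D p)) p = obj_inv G \<iota> (cdom D p)"
      using act_res_ident_left by auto
    show "g \<in> arrs G \<Longrightarrow> \<iota> (ccod G g) = act g (\<iota> (cdom G g))"
      "g \<in> arrs G \<Longrightarrow> res g (\<iota> (cdom G g)) = g"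
      using act_res_ident_right by auto
    assume g: "g \<in> arrs G"
    {
      assume p: "p \<in> arrs D" and "\<iota> (cdom G g) = ccod D p"
      then have gp: "g \<in> U" "cdom C g = ccod C (ev p)"
        using g actable_iff by (auto simp del: ccod_D)
      note P = act_res[OF gp(1) p gp(2)] act_res_ends[OF gp(1) p gp(2)]
      show "act g p \<in> arrs D" "res g p \<in> arrs G" "ccod D (act g p) = \<iota> (ccod G g)"
        "cdom D (act g p) = \<iota> (ccod G (res g p))" "cdom D p = \<iota> (cdom G (res g p))"
        using P p by auto
      assume q: "q \<in> arrs D" "cdom D p = ccod D q"
      show "res g (p \<cdot>\<^bsub>D\<^esub> q) = res (res g p) q"
        "act g (p \<cdot>\<^bsub>D\<^esub> q) = act g p \<cdot>\<^bsub>D\<^esub> act (res g p) q"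
        using act_res_mul_right[OF gp(1) p q(1) gp(2) q(2)] by auto
    }
    assume h: "h \<in> arrs G" "cdom G g = ccod G h"
      and p: "p \<in> arrs D" "\<iota> (cdom G h) = ccod D p"
    then have "h \<in> U" "cdom C h = ccod C (ev p)"
      using actable_iff by (auto simp del: ccod_D)
    then show "act (g \<cdot>\<^bsub>G\<^esub> h) p = act g (act h p)"
      "res (g \<cdot>\<^bsub>G\<^esub> h) p = res g (act h p) \<cdot>\<^bsub>G\<^esub> res h p"
      using act_res_mul_left[of g h p] g h p by auto
  qed
qed

text \<open>
  The multiplication of the Zappa-Szep product is read off from \<open>(pg)(qh) = p(gq)h\<close>, in which \<open>gq\<close>
  is replaced by its factorization.
\<close>

lemma factors_mul:
  assumes c: "factors c (p, g)" and c': "factors c' (q, h)" and comp: "cdom C c = ccod C c'"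
  shows "factors (c \<cdot> c') (p \<cdot>\<^bsub>D\<^esub> act g q, res g q \<cdot> h)"
proof -
  note [simp] = ev_closed U_closed
  have C: "p \<in> arrs D" "g \<in> U" "cdom C (ev p) = ccod C g" "ev p \<cdot> g = c"
    "q \<in> arrs D" "h \<in> U" "cdom C (ev q) = ccod C h" "ev q \<cdot> h = c'"
    using c c' by (auto simp: factors_def)
  have gq: "cdom C g = ccod C (ev q)"
    using comp C C.cdom_mul[of "ev p" g] C.ccod_mul[of "ev q" h] by auto
  note A = act_res[OF C(2,5) gq] act_res_ends[OF C(2,5) gq]
  have pq: "cdom D p = ccod D (act g q)"
    using A C by (simp add: composable_iff)
  have "ev (p \<cdot>\<^bsub>D\<^esub> act g q) \<cdot> (res g q \<cdot> h) = (ev p \<cdot> ev (act g q)) \<cdot> (res g q \<cdot> h)"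
    using A C pq by (simp add: ev_mul)
  also have "\<dots> = ev p \<cdot> (ev (act g q) \<cdot> (res g q \<cdot> h))"
    using A C by (intro C.mul_assoc) (auto simp: C.mul_closed C.ccod_mul)
  also have "ev (act g q) \<cdot> (res g q \<cdot> h) = (ev (act g q) \<cdot> res g q) \<cdot> h"
    using A C by (intro C.mul_assoc[symmetric]) auto
  also have "\<dots> = (g \<cdot> ev q) \<cdot> h" using A by simp
  also have "\<dots> = g \<cdot> (ev q \<cdot> h)"
    using C gq by (intro C.mul_assoc) auto
  also have "ev p \<cdot> (g \<cdot> (ev q \<cdot> h)) = (ev p \<cdot> g) \<cdot> (ev q \<cdot> h)"
    using C gq by (intro C.mul_assoc[symmetric]) (auto simp: C.mul_closed C.ccod_mul)
  also have "\<dots> = c \<cdot> c'" using C by simp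
  finally show ?thesis
    using A C pq by (intro factorsI D.mul_closed U_mul) (auto simp: ev_mul C.cdom_mul C.ccod_mul)
qed

lemma factors_ident: "e \<in> idents C \<Longrightarrow> factors e (\<iota> e, e)"
  using \<iota>_closed[of e] C.ident_simps[of e] D.ident_simps[of "\<iota> e"] C.mul_cdom[of e]
  by (intro factorsI) (auto simp: ev_\<iota> ident_U)

theorem category_isomorphic_zappa_szep:
  "category_isomorphic C (zappa_szep D G \<iota> act res)"
proof (rule category_isomorphicI)
  let ?Z = "zappa_szep D G \<iota> act res"
  note [simp] = ev_closed U_closed C.cdom_ident C.ccod_ident obj_inv_\<iota>
  have arrs_Z: "pg \<in> arrs ?Z \<longleftrightarrow> (\<exists>c. factors c pg)" for pg
    by (cases pg) (auto simp: zappa_szep_def factors_def cdom_D \<iota>_inject)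
  show "small_category C" by unfold_locales
  show "is_functor factorize C ?Z"
    unfolding is_functor_def
  proof (intro conjI ballI impI)
    fix c assume c: "c \<in> arrs C"
    obtain p g where pg: "factorize c = (p, g)" by fastforce
    then have f: "factors c (p, g)" using factors_factorize c by metis
    show "factorize c \<in> arrs ?Z" using arrs_Z f pg by auto
    have "cdom C c = cdom C g" "ccod C c = ccod C (ev p)"
      using f C.cdom_mul C.ccod_mul by (auto simp: factors_def)
    then show "factorize (cdom C c) = cdom ?Z (factorize c)"
      "factorize (ccod C c) = ccod ?Z (factorize c)"
      using factorize_eq[OF factors_ident] pg f
      by (auto simp: zappa_szep_def factors_def ccod_D)
    fix c' assume c': "c' \<in> arrs C" "cdom C c = ccod C c'"
    obtain q h where qh: "factorize c' = (q, h)" by fastforce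
    then have "factors c' (q, h)" using factors_factorize c' by metis
    then show "factorize (c \<cdot> c') = factorize c \<cdot>\<^bsub>?Z\<^esub> factorize c'"
      using factorize_eq[OF factors_mul[OF f _ c'(2)]] pg qh by (simp add: zappa_szep_def)
  qed
  have "inj_on factorize (arrs C)"
    using factors_factorize by (intro inj_onI) (metis (no_types, lifting) factors_det)
  moreover have "factorize ` arrs C = arrs ?Z"
    using arrs_Z factors_factorize factorize_eq factors_arr by (auto simp: image_iff) metis+
  ultimately show "bij_betw factorize (arrs C) (arrs ?Z)"
    by (simp add: bij_betw_def)
qed

end

section \<open>Units and atoms\<close>

context small_category
begin

definition units :: "'a set" where
  "units = {u \<in> arrs C. \<exists>v\<in>arrs C. cdom C v = ccod C u \<and> ccod C v = cdom C u \<and>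
     v \<cdot> u = cdom C u \<and> u \<cdot> v = ccod C u}"

definition atoms :: "'a set" where
  "atoms = {a \<in> arrs C - units. \<forall>b\<in>arrs C. \<forall>c\<in>arrs C.
     cdom C b = ccod C c \<longrightarrow> a = b \<cdot> c \<longrightarrow> b \<in> units \<or> c \<in> units}"

lemma units_closed: "u \<in> units \<Longrightarrow> u \<in> arrs C"
  by (simp add: units_def)

lemma unitsE:
  assumes "u \<in> units"
  obtains v where "v \<in> units" "cdom C v = ccod C u" "ccod C v = cdom C u"
     "v \<cdot> u = cdom C u" "u \<cdot> v = ccod C u"
  using assms unfolding units_def by (smt (verit) mem_Collect_eq)

lemma ident_unit: "e \<in> idents C \<Longrightarrow> e \<in> units"
  using ident_simps[of e] mul_cdom[of e] by (auto simp: units_def intro!: bexI[of _ e])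

lemma mul_inverse_cancel:
  assumes "u \<in> arrs C" "v \<in> arrs C" "x \<in> arrs C" "cdom C u = ccod C v" "cdom C v = ccod C x"
    "u \<cdot> v = ccod C x"
  shows "u \<cdot> (v \<cdot> x) = x"
  using assms by (metis mul_assoc ccod_mul_self)

lemma units_mul:
  assumes u: "u \<in> units" and v: "v \<in> units" and uv: "cdom C u = ccod C v"
  shows "u \<cdot> v \<in> units"
proof -
  obtain u' where u': "u' \<in> units" "cdom C u' = ccod C u" "ccod C u' = cdom C u"
    "u' \<cdot> u = cdom C u" "u \<cdot> u' = ccod C u" using unitsE[OF u] .
  obtain v' where v': "v' \<in> units" "cdom C v' = ccod C v" "ccod C v' = cdom C v"
    "v' \<cdot> v = cdom C v" "v \<cdot> v' = ccod C v" using unitsE[OF v] .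
  note arr = u u' v v' uv units_closed mul_closed cdom_mul ccod_mul
  have "(v' \<cdot> u') \<cdot> (u \<cdot> v) = v' \<cdot> (u' \<cdot> (u \<cdot> v))"
    using arr by (intro mul_assoc) auto
  also have "u' \<cdot> (u \<cdot> v) = v" using arr by (intro mul_inverse_cancel) auto
  finally have 1: "(v' \<cdot> u') \<cdot> (u \<cdot> v) = cdom C v" using v' by simp
  have "(u \<cdot> v) \<cdot> (v' \<cdot> u') = u \<cdot> (v \<cdot> (v' \<cdot> u'))"
    using arr by (intro mul_assoc) auto
  also have "v \<cdot> (v' \<cdot> u') = u'" using arr by (intro mul_inverse_cancel) auto
  finally have 2: "(u \<cdot> v) \<cdot> (v' \<cdot> u') = ccod C u" using u' by simp
  have "v' \<cdot> u' \<in> arrs C" "u \<cdot> v \<in> arrs C" using arr by auto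
  with 1 2 show ?thesis
    unfolding units_def using arr by (auto intro!: bexI[of _ "v' \<cdot> u'"])
qed

lemma groupoid_units: "groupoid (C\<lparr>arrs := units\<rparr>)"
proof -
  note [simp] = units_closed
  show ?thesis
  proof
    fix x assume x: "x \<in> arrs (C\<lparr>arrs := units\<rparr>)"
    then show "\<exists>h\<in>arrs (C\<lparr>arrs := units\<rparr>).
            cdom (C\<lparr>arrs := units\<rparr>) h = ccod (C\<lparr>arrs := units\<rparr>) x \<and>
            ccod (C\<lparr>arrs := units\<rparr>) h = cdom (C\<lparr>arrs := units\<rparr>) x \<and>
            h \<cdot>\<^bsub>C\<lparr>arrs := units\<rparr>\<^esub> x = cdom (C\<lparr>arrs := units\<rparr>) x \<and>
            x \<cdot>\<^bsub>C\<lparr>arrs := units\<rparr>\<^esub> h = ccod (C\<lparr>arrs := units\<rparr>) x"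
      by (auto elim: unitsE)
  qed (auto simp: ident_unit cdom_ident ccod_ident cdom_cdom ccod_cdom cdom_ccod ccod_ccod
      units_mul cdom_mul ccod_mul mul_cdom ccod_mul_self mul_assoc)
qed

lemma atom_closed: "a \<in> atoms \<Longrightarrow> a \<in> arrs C"
  by (simp add: atoms_def)

lemma atom_not_unit: "a \<in> atoms \<Longrightarrow> a \<notin> units"
  by (simp add: atoms_def)

lemma atomD: "\<lbrakk>b \<cdot> c \<in> atoms; b \<in> arrs C; c \<in> arrs C; cdom C b = ccod C c\<rbrakk>
    \<Longrightarrow> b \<in> units \<or> c \<in> units"
  unfolding atoms_def by blast

lemma self_in_ideal: "x \<in> arrs C \<Longrightarrow> x \<in> principal_right_ideal C x"
  unfolding principal_right_ideal_def using mul_cdom[of x] cdom_closed[of x] ccod_cdom[of x]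
  by (auto intro!: exI[of _ "cdom C x"])

lemma mul_in_ideal: "\<lbrakk>y \<in> arrs C; cdom C x = ccod C y\<rbrakk> \<Longrightarrow> x \<cdot> y \<in> principal_right_ideal C x"
  unfolding principal_right_ideal_def by blast

lemma ideal_mul_subset:
  assumes "x \<in> arrs C" "y \<in> arrs C" "cdom C x = ccod C y"
  shows "principal_right_ideal C (x \<cdot> y) \<subseteq> principal_right_ideal C x"
proof
  fix w assume "w \<in> principal_right_ideal C (x \<cdot> y)"
  then obtain z where z: "w = (x \<cdot> y) \<cdot> z" "z \<in> arrs C" "cdom C y = ccod C z"
    unfolding principal_right_ideal_def using assms cdom_mul by auto
  then have "w = x \<cdot> (y \<cdot> z)" using assms mul_assoc by simp
  then show "w \<in> principal_right_ideal C x"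
    using z assms mul_closed ccod_mul by (auto intro: mul_in_ideal)
qed

lemma ideal_subsetE:
  assumes "x \<in> arrs C" "principal_right_ideal C x \<subseteq> principal_right_ideal C y"
  obtains z where "z \<in> arrs C" "cdom C y = ccod C z" "x = y \<cdot> z"
  using assms self_in_ideal[of x] unfolding principal_right_ideal_def by blast

lemma ideal_mul_unit:
  assumes x: "x \<in> arrs C" and u: "u \<in> units" and xu: "cdom C x = ccod C u"
  shows "principal_right_ideal C (x \<cdot> u) = principal_right_ideal C x"
proof
  obtain v where v: "v \<in> units" "cdom C v = ccod C u" "ccod C v = cdom C u"
    "v \<cdot> u = cdom C u" "u \<cdot> v = ccod C u" using unitsE[OF u] .
  note arr = x u v xu units_closed
  show "principal_right_ideal C (x \<cdot> u) \<subseteq> principal_right_ideal C x"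
    using arr by (intro ideal_mul_subset) auto
  have "(x \<cdot> u) \<cdot> v = x \<cdot> (u \<cdot> v)" using arr by (intro mul_assoc) auto
  then have "(x \<cdot> u) \<cdot> v = x" using arr mul_cdom[of x] by simp
  moreover have "principal_right_ideal C ((x \<cdot> u) \<cdot> v) \<subseteq> principal_right_ideal C (x \<cdot> u)"
    using arr mul_closed cdom_mul by (intro ideal_mul_subset) auto
  ultimately show "principal_right_ideal C x \<subseteq> principal_right_ideal C (x \<cdot> u)" by simp
qed

end

section \<open>Unique factorization in left Rees categories\<close>

context left_rees_category
begin

lemma mul_eq_self_ident:
  assumes x: "x \<in> arrs C" and y: "y \<in> arrs C" and xy: "cdom C x = ccod C y" and eq: "x \<cdot> y = x"
  shows "y = cdom C x"
proof (rule left_cancellative[OF x y cdom_closed[OF x] xy])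
  show "cdom C x = ccod C (cdom C x)" using ccod_cdom[OF x] by simp
  show "x \<cdot> y = x \<cdot> cdom C x" using eq mul_cdom[OF x] by simp
qed

text \<open>
  If \<open>xy\<close> is an identity then \<open>x(yx) = x\<close>, and cancelling \<open>x\<close> shows that \<open>yx\<close> is an identity too.
\<close>

lemma right_invertible_unit:
  assumes x: "x \<in> arrs C" and y: "y \<in> arrs C" and xy: "cdom C x = ccod C y"
    and inv: "x \<cdot> y = ccod C x"
  shows "x \<in> units"
proof -
  have yx: "cdom C y = ccod C x" using cdom_mul[OF x y xy] inv cdom_ccod x by simp
  have "x \<cdot> (y \<cdot> x) = x"
    using mul_assoc[OF x y x xy yx] inv ccod_mul_self[OF x] by simp
  then have "y \<cdot> x = cdom C x"
    using mul_eq_self_ident[OF x mul_closed[OF y x yx]] ccod_mul[OF y x yx] xy by simp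
  then show ?thesis
    using x y xy yx inv unfolding units_def by auto
qed

lemma mul_unit_left_factor:
  assumes x: "x \<in> arrs C" and y: "y \<in> arrs C" and xy: "cdom C x = ccod C y"
    and u: "x \<cdot> y \<in> units"
  shows "x \<in> units"
proof -
  obtain v where v: "v \<in> units" "ccod C v = cdom C (x \<cdot> y)" "(x \<cdot> y) \<cdot> v = ccod C (x \<cdot> y)"
    using unitsE[OF u] by metis
  then have "x \<cdot> (y \<cdot> v) = ccod C x"
    using x y xy units_closed by (simp add: mul_assoc ccod_mul cdom_mul)
  then show ?thesis
    using x y xy v units_closed
    by (intro right_invertible_unit[of x "y \<cdot> v"]) (auto simp: mul_closed ccod_mul cdom_mul)
qed

text \<open>
  From \<open>x = xyz\<close> cancellation yields a right inverse \<open>z\<close> of \<open>y\<close>. So multiplying by a non-unit on the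
  right makes the principal right ideal strictly smaller.
\<close>

lemma ideal_subset_mul_unit:
  assumes x: "x \<in> arrs C" and y: "y \<in> arrs C" and xy: "cdom C x = ccod C y"
    and sub: "principal_right_ideal C x \<subseteq> principal_right_ideal C (x \<cdot> y)"
  shows "y \<in> units"
proof -
  obtain z where z: "z \<in> arrs C" "cdom C (x \<cdot> y) = ccod C z" "x = (x \<cdot> y) \<cdot> z"
    using ideal_subsetE[OF x sub] .
  have yz: "cdom C y = ccod C z" using z x y xy cdom_mul by simp
  have "x \<cdot> (y \<cdot> z) = x"
    using mul_assoc[OF x y z(1) xy yz] z(3) by simp
  then have "y \<cdot> z = cdom C x"
    using mul_eq_self_ident[OF x mul_closed[OF y z(1) yz]] ccod_mul[OF y z(1) yz] xy by simp
  then show ?thesis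
    using right_invertible_unit[OF y z(1) yz] xy by simp
qed

lemma ideal_eqE:
  assumes x: "x \<in> arrs C" and y: "y \<in> arrs C"
    and eq: "principal_right_ideal C x = principal_right_ideal C y"
  obtains u where "u \<in> units" "cdom C x = ccod C u" "y = x \<cdot> u"
proof -
  obtain z where z: "z \<in> arrs C" "cdom C x = ccod C z" "y = x \<cdot> z"
    by (rule ideal_subsetE[OF y, of x]) (simp add: eq)
  then have "z \<in> units" using ideal_subset_mul_unit[OF x z(1,2)] eq by simp
  with z show ?thesis using that by blast
qed

text \<open>
  A factorization of \<open>ua\<close> becomes one of \<open>a\<close> after multiplication by the inverse of \<open>u\<close> on the left.
\<close>

lemma unit_mul_atom:
  assumes u: "u \<in> units" and a: "a \<in> atoms" and ua: "cdom C u = ccod C a"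
  shows "u \<cdot> a \<in> atoms"
proof -
  note arr = atom_closed[OF a] units_closed[OF u]
  obtain v where v: "v \<in> units" "cdom C v = ccod C u" "ccod C v = cdom C u"
    "v \<cdot> u = cdom C u" "u \<cdot> v = ccod C u" using unitsE[OF u] .
  have a_eq: "v \<cdot> (u \<cdot> a) = a"
    using arr v ua units_closed by (intro mul_inverse_cancel) auto
  have "b \<in> units \<or> c \<in> units"
    if bc: "b \<in> arrs C" "c \<in> arrs C" "cdom C b = ccod C c" "u \<cdot> a = b \<cdot> c" for b c
  proof -
    have vb: "cdom C v = ccod C b"
      using v bc arr ua by (metis ccod_mul)
    have "a = (v \<cdot> b) \<cdot> c" using a_eq bc v units_closed vb by (simp add: mul_assoc)
    then have "v \<cdot> b \<in> units \<or> c \<in> units"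
      using atomD[of "v \<cdot> b" c] a bc vb v units_closed by (auto simp: mul_closed cdom_mul)
    moreover have "b = u \<cdot> (v \<cdot> b)"
      using arr v bc vb units_closed by (intro mul_inverse_cancel[symmetric]) auto
    ultimately show ?thesis
      using units_mul[OF u, of "v \<cdot> b"] v vb bc units_closed by (auto simp: ccod_mul)
  qed
  moreover have "u \<cdot> a \<notin> units"
  proof
    assume "u \<cdot> a \<in> units"
    then have "v \<cdot> (u \<cdot> a) \<in> units"
      using v arr ua by (intro units_mul[of v "u \<cdot> a"]) (simp_all add: ccod_mul)
    then show False using a_eq atom_not_unit[OF a] by simp
  qed
  ultimately show ?thesis using arr ua mul_closed unfolding atoms_def by blast
qed

text \<open>
  Rigidity makes the two ideals comparable; if \<open>aC\<close> is contained in \<open>bC\<close>, then \<open>a = bz\<close> with \<open>b\<close> not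
  a unit, so \<open>z\<close> is a unit because \<open>a\<close> is an atom.
\<close>

lemma atoms_ideal_eq:
  assumes a: "a \<in> atoms" and b: "b \<in> atoms"
    and meet: "principal_right_ideal C a \<inter> principal_right_ideal C b \<noteq> {}"
  shows "principal_right_ideal C a = principal_right_ideal C b"
proof -
  have eq: "principal_right_ideal C x = principal_right_ideal C y"
    if x: "x \<in> atoms" and y: "y \<in> atoms"
      and sub: "principal_right_ideal C x \<subseteq> principal_right_ideal C y" for x y
  proof -
    obtain z where z: "z \<in> arrs C" "cdom C y = ccod C z" "x = y \<cdot> z"
      using ideal_subsetE[OF atom_closed[OF x] sub] .
    then have "z \<in> units" using atomD[of y z] x atom_closed[OF y] atom_not_unit[OF y] by auto
    then show ?thesis using ideal_mul_unit z atom_closed[OF y] by simp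
  qed
  show ?thesis
    using right_rigid[OF atom_closed[OF a] atom_closed[OF b] meet] eq[OF a b] eq[OF b a] by auto
qed

text \<open>
  The ideal \<open>bC\<close> is chosen minimal among the finitely many ideals properly above \<open>cC\<close>; the
  identity \<open>ccod C c\<close> generates one of these since \<open>c\<close> is not a unit. A splitting \<open>a = de\<close> of the
  remaining factor gives an ideal \<open>bdC\<close> between \<open>cC\<close> and \<open>bC\<close>, which must be one of the two.
\<close>

lemma ex_atom_right_factor:
  assumes c: "c \<in> arrs C" and nu: "c \<notin> units"
  obtains b a where "b \<in> arrs C" "a \<in> atoms" "cdom C b = ccod C a" "c = b \<cdot> a"
    "principal_right_ideal C c \<subset> principal_right_ideal C b"
proof -
  let ?R = "principal_right_ideal C"
  let ?S = "{I \<in> ?R ` arrs C. ?R c \<subset> I}"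
  have "?R c \<subseteq> ?R (ccod C c)"
    using ideal_mul_subset[of "ccod C c" c] c ccod_closed cdom_ccod ccod_mul_self by simp
  moreover have "\<not> ?R (ccod C c) \<subseteq> ?R c"
    using ideal_subset_mul_unit[of "ccod C c" c] c nu ccod_closed cdom_ccod ccod_mul_self by auto
  ultimately have "?R (ccod C c) \<in> ?S" using c ccod_closed by blast
  then have "?S \<noteq> {}" by blast
  with finite_above[OF c] have "\<exists>I\<in>?S. \<forall>J\<in>?S. J \<subseteq> I \<longrightarrow> I = J"
    by (rule finite_has_minimal)
  then obtain I where I: "I \<in> ?S" "\<And>J. J \<in> ?S \<Longrightarrow> J \<subseteq> I \<Longrightarrow> I = J"
    by (elim bexE) (rule that, blast+)
  then obtain b where b: "b \<in> arrs C" "I = ?R b" "?R c \<subset> ?R b" by blast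
  obtain a where a: "a \<in> arrs C" "cdom C b = ccod C a" "c = b \<cdot> a"
    using ideal_subsetE[OF c, of b] b(3) by blast
  have "a \<notin> units" using ideal_mul_unit[of b a] a b by auto
  moreover have "d \<in> units \<or> e \<in> units"
    if de: "d \<in> arrs C" "e \<in> arrs C" "cdom C d = ccod C e" "a = d \<cdot> e" for d e
  proof -
    have bd: "cdom C b = ccod C d" using a de ccod_mul by simp
    then have bd': "b \<cdot> d \<in> arrs C" "cdom C (b \<cdot> d) = ccod C e"
      using b de mul_closed cdom_mul by auto
    have c_eq: "c = (b \<cdot> d) \<cdot> e" using a b de bd mul_assoc by simp
    have sub: "?R c \<subseteq> ?R (b \<cdot> d)" "?R (b \<cdot> d) \<subseteq> ?R b"
      using ideal_mul_subset[of "b \<cdot> d" e] ideal_mul_subset[of b d] c_eq bd' bd de b by auto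
    show ?thesis
    proof (cases "?R (b \<cdot> d) \<subseteq> ?R c")
      case True
      then show ?thesis using ideal_subset_mul_unit[of "b \<cdot> d" e] bd' de c_eq by auto
    next
      case False
      then have "?R (b \<cdot> d) \<in> ?S" using sub bd' by blast
      then have "?R b = ?R (b \<cdot> d)" using I(2) sub b by auto
      then show ?thesis using ideal_subset_mul_unit[of b d] b de bd by auto
    qed
  qed
  ultimately have "a \<in> atoms" using a unfolding atoms_def by blast
  then show ?thesis using that a b by blast
qed

text \<open>
  A transversal of the ideals generated by atoms: the choice depends on \<open>x\<close> only through the
  ideal \<open>xC\<close>.
\<close>

definition atom_representatives :: "'a set" where
  "atom_representatives = {x \<in> atoms.
     x = (SOME a. a \<in> atoms \<and> principal_right_ideal C a = principal_right_ideal C x)}"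

lemma representative_unique:
  assumes "x \<in> atom_representatives" "y \<in> atom_representatives"
    "principal_right_ideal C x = principal_right_ideal C y"
  shows "x = y"
  using assms by (simp add: atom_representatives_def)

lemma representative_atom: "x \<in> atom_representatives \<Longrightarrow> x \<in> atoms"
  by (simp add: atom_representatives_def)

lemma representatives_closed: "atom_representatives \<subseteq> arrs C"
  using representative_atom atom_closed by blast

lemma ex_representative:
  assumes a: "a \<in> atoms"
  obtains x u where "x \<in> atom_representatives" "u \<in> units" "cdom C x = ccod C u" "a = x \<cdot> u"
proof -
  define x where "x = (SOME b. b \<in> atoms \<and> principal_right_ideal C b = principal_right_ideal C a)"
  have x: "x \<in> atoms \<and> principal_right_ideal C x = principal_right_ideal C a"
    unfolding x_def by (rule someI[of _ a]) (simp add: a)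
  then have "x \<in> atom_representatives"
    unfolding atom_representatives_def using x_def by simp
  then show ?thesis
    using ideal_eqE[of x a] x a atom_closed that by metis
qed

abbreviation atom_graph :: "('a, 'a) pre_digraph" where
  "atom_graph \<equiv> subgraph_on C atom_representatives"

abbreviation paths :: "('a, 'a) free_arrow category" where
  "paths \<equiv> free_category atom_graph"

lemma wf_atom_graph: "wf_digraph atom_graph"
  by (rule wf_digraph_subgraph_on[OF representatives_closed])

lemma free_eval_ends:
  assumes "p \<in> arrs paths"
  shows "free_eval C p \<in> arrs C" "cdom paths p = Vertex (cdom C (free_eval C p))"
proof -
  have F: "free_eval C p \<in> arrs C" "free_eval C (cdom paths p) = cdom C (free_eval C p)"
    using is_functor_free_eval[OF representatives_closed] assms unfolding is_functor_def by blast+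
  then show "free_eval C p \<in> arrs C" by simp
  have "cdom paths p = Vertex (free_eval C (cdom paths p))"
    by (cases p) (simp_all add: free_category_def)
  then show "cdom paths p = Vertex (cdom C (free_eval C p))"
    using F by simp
qed

text \<open>
  The induction is on the number of principal right ideals properly above \<open>cC\<close>, which is
  smaller for the left factor \<open>b\<close> of \<open>c = ba\<close> because \<open>bC\<close> itself no longer counts.
\<close>

lemma ex_factorization:
  assumes "c \<in> arrs C"
  shows "\<exists>p g. p \<in> arrs paths \<and> g \<in> units \<and> cdom C (free_eval C p) = ccod C g \<and>
    free_eval C p \<cdot> g = c"
  using assms
proof (induction "card {I \<in> principal_right_ideal C ` arrs C. principal_right_ideal C c \<subset> I}"
    arbitrary: c rule: less_induct)
  case (less c)
  let ?above = "\<lambda>c. {I \<in> principal_right_ideal C ` arrs C. principal_right_ideal C c \<subset> I}"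
  show ?case
  proof (cases "c \<in> units")
    case True
    then show ?thesis
      using less.prems ccod_ident[of c] ident_simps ccod_mul_self
      by (intro exI[of _ "Vertex (ccod C c)"] exI[of _ c])
        (auto simp: free_category_def subgraph_on_def)
  next
    case False
    obtain b a where ba: "b \<in> arrs C" "a \<in> atoms" "cdom C b = ccod C a" "c = b \<cdot> a"
      "principal_right_ideal C c \<subset> principal_right_ideal C b"
      using ex_atom_right_factor[OF less.prems False] .
    have "?above b \<subset> ?above c" using ba(1,5) by blast
    then have "card (?above b) < card (?above c)"
      using finite_above[OF less.prems] by (rule psubset_card_mono[rotated])
    from less.hyps[OF this ba(1)] obtain p g where
      pg: "p \<in> arrs paths" "g \<in> units" "cdom C (free_eval C p) = ccod C g" "free_eval C p \<cdot> g = b"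
      by blast
    note P = free_eval_ends[OF pg(1)]
    have a: "a \<in> arrs C" and g: "g \<in> arrs C" using ba pg atom_closed units_closed by auto
    have ga: "cdom C g = ccod C a" using pg P ba g cdom_mul by auto
    obtain x u where xu: "x \<in> atom_representatives" "u \<in> units" "cdom C x = ccod C u" "g \<cdot> a = x \<cdot> u"
      using ex_representative[OF unit_mul_atom[OF pg(2) ba(2) ga]] .
    have x: "x \<in> arrs C" and u: "u \<in> arrs C" using xu representatives_closed units_closed by auto
    have px: "cdom C (free_eval C p) = ccod C x"
      using xu(4) pg(3) ccod_mul[OF g a ga] ccod_mul[OF x u xu(3)] by simp
    have wx: "Word [x] \<in> arrs paths"
      using xu by (simp add: free_category_def subgraph_on_def)
    have comp: "cdom paths p = ccod paths (Word [x])"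
      using P px by (simp add: free_category_def subgraph_on_def)
    interpret paths: small_category paths
      by (rule small_category_free_category[OF wf_atom_graph])
    have q: "p \<cdot>\<^bsub>paths\<^esub> Word [x] \<in> arrs paths"
      using pg(1) wx comp by (rule paths.mul_closed)
    have ev: "free_eval C (p \<cdot>\<^bsub>paths\<^esub> Word [x]) = free_eval C p \<cdot> x"
      using is_functor_free_eval[OF representatives_closed] pg wx comp
      by (auto simp: is_functor_def)
    have "c = free_eval C p \<cdot> (g \<cdot> a)"
      using ba(4) pg P g a ga mul_assoc by auto
    also have "\<dots> = (free_eval C p \<cdot> x) \<cdot> u"
      using P x u xu px mul_assoc by simp
    finally show ?thesis
      using q ev xu px P x by (intro exI[of _ "p \<cdot>\<^bsub>paths\<^esub> Word [x]"] exI[of _ u])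
        (auto simp: cdom_mul)
  qed
qed

text \<open>
  Leading edges of equal products generate ideals that meet, so they coincide and cancel.
  The two words have equally many edges: otherwise an edge times something would be a
  unit, and the edge itself would be a unit.
\<close>

lemma word_product_cancel:
  assumes "set xs \<subseteq> atom_representatives" "set ys \<subseteq> atom_representatives"
    "g \<in> units" "h \<in> units" "walk C (xs @ [g])" "walk C (ys @ [h])"
    "word_product C (xs @ [g]) = word_product C (ys @ [h])"
  shows "xs = ys \<and> g = h"
  using assms
proof (induction xs arbitrary: ys)
  have split: "x \<in> arrs C \<and> walk C (zs @ [k]) \<and> cdom C x = ccod C (word_product C (zs @ [k])) \<and>
      word_product C (x # zs @ [k]) = x \<cdot> word_product C (zs @ [k]) \<and>
      word_product C (zs @ [k]) \<in> arrs C"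
    if "walk C (x # zs @ [k])" for x zs k
    using that walk_append[of "[x]" "zs @ [k]"] word_product_walk[of "zs @ [k]"]
      word_product_Cons[of "zs @ [k]" x] by (simp add: walk_def)
  have not_unit: False
    if "x \<in> atom_representatives" "walk C (x # zs @ [k])" "word_product C (x # zs @ [k]) \<in> units"
    for x zs k
    using split[OF that(2)] that mul_unit_left_factor representative_atom atom_not_unit by metis
  {
    case Nil
    show ?case
    proof (cases ys)
      case (Cons y zs)
      then show ?thesis using not_unit[of y zs h] Nil by auto
    qed (use Nil in auto)
  next
    case (Cons x xs)
    show ?case
    proof (cases ys)
      case Nil
      then show ?thesis using not_unit[of x xs g] Cons.prems by auto
    next
      case ys: (Cons y zs)
      have x: "x \<in> atom_representatives" and y: "y \<in> atom_representatives"
        using Cons.prems ys by auto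
      have wx: "walk C (x # xs @ [g])" and wy: "walk C (y # zs @ [h])"
        using Cons.prems ys by auto
      note X = split[OF wx] and Y = split[OF wy]
      have eq: "x \<cdot> word_product C (xs @ [g]) = y \<cdot> word_product C (zs @ [h])"
        using X Y Cons.prems ys by auto
      then have "principal_right_ideal C x \<inter> principal_right_ideal C y \<noteq> {}"
        using mul_in_ideal[of "word_product C (xs @ [g])" x]
          mul_in_ideal[of "word_product C (zs @ [h])" y] X Y by auto
      then have "x = y"
        using x y atoms_ideal_eq representative_atom representative_unique by blast
      moreover from this eq have "word_product C (xs @ [g]) = word_product C (zs @ [h])"
        using left_cancellative[of x] X Y by auto
      then have "xs = zs \<and> g = h"
        using Cons.IH[of zs] Cons.prems ys X Y by auto
      ultimately show ?thesis using ys by simp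
    qed
  }
qed

text \<open>
  Both kinds of arrows of the free category, vertices and non-empty words, followed by a
  unit \<open>g\<close>, become words that end in \<open>g\<close>. The vertex is determined by \<open>g\<close>, so no information
  is lost.
\<close>

lemma free_eval_mul_unit:
  assumes p: "p \<in> arrs paths" and g: "g \<in> units" and pg: "cdom C (free_eval C p) = ccod C g"
  obtains (Vertex) "p = Vertex (ccod C g)" "free_eval C p \<cdot> g = word_product C ([] @ [g])"
      "walk C ([] @ [g])"
  | (Word) xs where "p = Word xs" "xs \<noteq> []" "set xs \<subseteq> atom_representatives"
      "free_eval C p \<cdot> g = word_product C (xs @ [g])" "walk C (xs @ [g])"
  using p
proof (cases rule: arrs_free_category_cases)
  case (Vertex v)
  then have "p = Vertex (ccod C g)"
    using pg ident_simps[of v] by (simp add: subgraph_on_def)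
  then show ?thesis
    using that(1) ccod_mul_self g units_closed by (simp add: walk_def)
next
  case (Word xs)
  then have w: "walk C xs" "walk C [g]" "set xs \<subseteq> atom_representatives"
    using representatives_closed g units_closed by (auto simp: walk_def subgraph_on_def)
  then have l: "cdom C (last xs) = ccod C (hd [g])"
    using word_product_walk pg Word by simp
  then show ?thesis
    using that(2)[of xs] w word_product_append[OF w(1,2) l] walk_append[of xs "[g]"] Word by simp
qed

lemma factorization_unique:
  assumes p: "p \<in> arrs paths" "g \<in> units" "cdom C (free_eval C p) = ccod C g"
    and q: "q \<in> arrs paths" "h \<in> units" "cdom C (free_eval C q) = ccod C h"
    and eq: "free_eval C p \<cdot> g = free_eval C q \<cdot> h"
  shows "p = q \<and> g = h"
  using p
proof (cases rule: free_eval_mul_unit)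
  case P: Vertex
  show ?thesis using q
  proof (cases rule: free_eval_mul_unit)
    case Vertex
    then show ?thesis using P eq by simp
  next
    case (Word ys)
    then show ?thesis using P eq word_product_cancel[of "[]" ys g h] p q by auto
  qed
next
  case P: (Word xs)
  show ?thesis using q
  proof (cases rule: free_eval_mul_unit)
    case Vertex
    then show ?thesis using P eq word_product_cancel[of xs "[]" g h] p q by auto
  next
    case (Word ys)
    then show ?thesis using P eq word_product_cancel[of xs ys g h] p q by auto
  qed
qed

lemma internal_zappa_szep_paths_units: "internal_zappa_szep C paths units (free_eval C) Vertex"
proof -
  interpret paths: small_category paths
    by (rule small_category_free_category[OF wf_atom_graph])
  have "small_category C" "small_category paths"
    by unfold_locales
  then show ?thesis
  proof (intro internal_zappa_szep.intro internal_zappa_szep_axioms.intro)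
    show "units \<subseteq> arrs C" "idents C \<subseteq> units" "groupoid (C\<lparr>arrs := units\<rparr>)"
      "is_functor (free_eval C) paths C"
      using units_closed ident_unit groupoid_units is_functor_free_eval[OF representatives_closed]
      by auto
    show "bij_betw Vertex (idents C) (idents paths)"
      by (auto simp: idents_free_category subgraph_on_def bij_betw_def inj_on_def)
    show "free_eval C (Vertex e) = e" for e by simp
    show "\<exists>!(p, g). p \<in> arrs paths \<and> g \<in> units \<and> cdom C (free_eval C p) = ccod C g \<and>
        free_eval C p \<cdot> g = c" if c: "c \<in> arrs C" for c
    proof -
      obtain p g where "p \<in> arrs paths \<and> g \<in> units \<and> cdom C (free_eval C p) = ccod C g \<and>
        free_eval C p \<cdot> g = c" using ex_factorization[OF c] by blast
      then show ?thesis using factorization_unique by (intro ex1I[of _ "(p, g)"]) auto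
    qed
  qed
qed

end

theorem proposition3p2p4:
  fixes C :: "'a category"
  assumes "left_rees_category C"
  shows "\<exists>(\<G> :: ('a, 'a) pre_digraph) (G :: 'a category) \<iota> act res.
    wf_digraph \<G> \<and> groupoid G \<and>
    self_similar_action G (free_category \<G>) \<iota> act res \<and>
    category_isomorphic C (zappa_szep (free_category \<G>) G \<iota> act res)"
proof -
  interpret left_rees_category C by fact
  interpret Z: internal_zappa_szep C paths units "free_eval C" Vertex
    by (rule internal_zappa_szep_paths_units)
  show ?thesis
    using wf_atom_graph groupoid_units Z.self_similar_action Z.category_isomorphic_zappa_szep
    by blast
qed

end
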